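(* Let $n>1$ and let $A$ be an $n\times n$ complex matrix that has a unique SDP-representor $Z$. If $A$ has the multiplicity property, then $A$ is a disk matrix.
   Context: Field of values: $W(A)=\{u^*Au : u\in\mathbb{C}^n,\ \|u\|_2=1\}$. Numerical radius: $r(A)=\max\{|z| : z\in W(A)\}$. A matrix $A$ is a disk matrix if its field of values is a disk centered at zero, i.e. $W(A)=\{z\in\mathbb{C}: |z|\le r(A)\}$ (the zero matrix, with $W(A)=\{0\}$, is the degenerate case $r(A)=0$). For an $n\times n$ Hermitian matrix $Z$, put $\Phi_A(Z)=\begin{bmatrix} Z & A\\ A^* & -Z\end{bmatrix}$, a $2n\times 2n$ Hermitian matrix, and let $\lambda_{\max}$ denote the largest eigenvalue. An SDP-representor for $A$ is any minimizer, over all $n\times n$ Hermitian matrices $Z$, of the function $Z\mapsto\lambda_{\max}(\Phi_A(Z))$. The matrix $A$ has the multiplicity property if there exists an SDP-representor $Z$ for $A$ such that the largest eigenvalue of $\Phi_A(Z)$ has multiplicity strictly larger than $n$. *)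

theory Defs
  imports "HOL-Analysis.Analysis"
begin

text \<open>
  The norm on \<^typ>\<open>complex ^ 'n\<close> is the Euclidean norm. The library's inner product there is the
  real one, so the Hermitian form \<open>u* v\<close> is introduced separately.
\<close>

definition cinner_vec :: "complex ^ 'n \<Rightarrow> complex ^ 'n \<Rightarrow> complex" where
  "cinner_vec u v = (\<Sum>i\<in>UNIV. cnj (u $ i) * v $ i)"

definition ctranspose :: "complex ^ 'n ^ 'm \<Rightarrow> complex ^ 'm ^ 'n" where
  "ctranspose A = (\<chi> i j. cnj (A $ j $ i))"

definition hermitian :: "complex ^ 'n ^ 'n \<Rightarrow> bool" where
  "hermitian A \<longleftrightarrow> ctranspose A = A"

definition field_of_values :: "complex ^ 'n ^ 'n \<Rightarrow> complex set" where
  "field_of_values A = {cinner_vec u (A *v u) | u. norm u = 1}"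

text \<open>The field of values is compact and nonempty, so this supremum is a maximum.\<close>

definition numerical_radius :: "complex ^ 'n ^ 'n \<Rightarrow> real" where
  "numerical_radius A = (SUP z\<in>field_of_values A. cmod z)"

definition disk_matrix :: "complex ^ 'n ^ 'n \<Rightarrow> bool" where
  "disk_matrix A \<longleftrightarrow> field_of_values A = {z. cmod z \<le> numerical_radius A}"

definition eigenspace :: "complex ^ 'n ^ 'n \<Rightarrow> complex \<Rightarrow> (complex ^ 'n) set" where
  "eigenspace M \<mu> = {v. M *v v = \<mu> *s v}"

definition eigenvalue :: "complex ^ 'n ^ 'n \<Rightarrow> complex \<Rightarrow> bool" where
  "eigenvalue M \<mu> \<longleftrightarrow> (\<exists>v. v \<noteq> 0 \<and> M *v v = \<mu> *s v)"

text \<open>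
  The following two notions are applied to Hermitian matrices only. Their eigenvalues are real and
  form a finite nonempty set, and the algebraic multiplicity of an eigenvalue is the complex
  dimension of its eigenspace.
\<close>

definition lambda_max :: "complex ^ 'n ^ 'n \<Rightarrow> real" where
  "lambda_max M = Max {x. eigenvalue M (of_real x)}"

definition multiplicity_of :: "complex ^ 'n ^ 'n \<Rightarrow> complex \<Rightarrow> nat" where
  "multiplicity_of M \<mu> = vec.dim (eigenspace M \<mu>)"

text \<open>
  The \<open>2n \<times> 2n\<close> block matrix with rows \<open>[Z, A]\<close> and \<open>[A*, -Z]\<close>; indices \<open>Inl i\<close> address the first
  block and \<open>Inr i\<close> the second.
\<close>

definition Phi :: "complex ^ 'n ^ 'n \<Rightarrow> complex ^ 'n ^ 'n \<Rightarrow> complex ^ ('n + 'n) ^ ('n + 'n)" where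
  "Phi A Z = (\<chi> k l. case k of
       Inl i \<Rightarrow> (case l of Inl j \<Rightarrow> Z $ i $ j | Inr j \<Rightarrow> A $ i $ j)
     | Inr i \<Rightarrow> (case l of Inl j \<Rightarrow> ctranspose A $ i $ j | Inr j \<Rightarrow> - (Z $ i $ j)))"

definition sdp_representor :: "complex ^ 'n ^ 'n \<Rightarrow> complex ^ 'n ^ 'n \<Rightarrow> bool" where
  "sdp_representor A Z \<longleftrightarrow> is_arg_min (\<lambda>Y. lambda_max (Phi A Y)) hermitian Z"

definition multiplicity_property :: "complex ^ 'n ^ 'n \<Rightarrow> bool" where
  "multiplicity_property A \<longleftrightarrow>
     (\<exists>Z. sdp_representor A Z \<and>
          multiplicity_of (Phi A Z) (of_real (lambda_max (Phi A Z))) > CARD('n))"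

end

theory Submission
  imports Defs
begin

text \<open>
  Let \<open>c\<close> be the largest eigenvalue of \<open>\<Phi>\<^sub>A(Z)\<close>. For \<open>|w| = 1\<close> the value of the form \<open>\<Phi>\<^sub>A(Z)\<close> at
  \<open>(x, w x)\<close> is \<open>2 Re (w x*Ax)\<close>, because the two contributions of \<open>Z\<close> cancel. As \<open>\<Phi>\<^sub>A(Z) \<le> c\<close>, this
  gives \<open>|x*Ax| \<le> c\<close> for unit vectors \<open>x\<close>. The vectors \<open>(x, w x)\<close> form an \<open>n\<close>-dimensional subspace
  of a \<open>2n\<close>-dimensional space, which meets every eigenspace of dimension greater than \<open>n\<close>. Hence for
  each such \<open>w\<close> some unit vector \<open>x\<close> has \<open>Re (w x*Ax) = c\<close>, so the field of values contains the whole
  circle of radius \<open>c\<close>, and by the Toeplitz-Hausdorff theorem the whole disk.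
\<close>

section \<open>The Hermitian form\<close>

lemma inner_eq_Re_cinner_vec: "x \<bullet> y = Re (cinner_vec x y)"
  by (simp add: inner_vec_def cinner_vec_def inner_complex_def)

lemma cinner_vec_self: "cinner_vec x x = of_real ((norm x)\<^sup>2)"
proof (rule complex_eqI)
  show "Re (cinner_vec x x) = Re (of_real ((norm x)\<^sup>2))"
    by (simp add: inner_eq_Re_cinner_vec[symmetric] power2_norm_eq_inner)
  show "Im (cinner_vec x x) = Im (of_real ((norm x)\<^sup>2))"
    by (simp add: cinner_vec_def)
qed

lemma cinner_vec_add_left: "cinner_vec (x + y) z = cinner_vec x z + cinner_vec y z"
  by (simp add: cinner_vec_def algebra_simps sum.distrib)

lemma cinner_vec_add_right: "cinner_vec x (y + z) = cinner_vec x y + cinner_vec x z"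
  by (simp add: cinner_vec_def algebra_simps sum.distrib)

lemma cinner_vec_diff_right: "cinner_vec x (y - z) = cinner_vec x y - cinner_vec x z"
  by (simp add: cinner_vec_def algebra_simps sum_subtractf)

lemma cinner_vec_scale_left: "cinner_vec (a *s x) y = cnj a * cinner_vec x y"
  by (simp add: cinner_vec_def sum_distrib_left algebra_simps)

lemma cinner_vec_scale_right: "cinner_vec x (a *s y) = a * cinner_vec x y"
  by (simp add: cinner_vec_def sum_distrib_left algebra_simps)

lemma cnj_cinner_vec: "cnj (cinner_vec x y) = cinner_vec y x"
  by (simp add: cinner_vec_def mult.commute)

lemma cinner_vec_ctranspose: "cinner_vec (ctranspose M *v u) v = cinner_vec u (M *v v)"
  unfolding cinner_vec_def matrix_vector_mult_def ctranspose_def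
  by (simp add: sum_distrib_left sum_distrib_right, subst sum.swap)
    (simp add: algebra_simps)

lemma ctranspose_ctranspose: "ctranspose (ctranspose M) = M"
  by (simp add: ctranspose_def vec_eq_iff)

lemma norm_vector_scalar_mult: "norm (a *s (x :: complex ^ 'n)) = cmod a * norm x"
proof -
  have "complex_of_real ((norm (a *s x))\<^sup>2) = of_real ((cmod a * norm x)\<^sup>2)"
    by (simp only: cinner_vec_self[symmetric] cinner_vec_scale_left cinner_vec_scale_right)
      (simp add: cinner_vec_self complex_norm_square[of a, unfolded of_real_power]
        power_mult_distrib mult_ac)
  then have "(norm (a *s x))\<^sup>2 = (cmod a * norm x)\<^sup>2"
    using of_real_eq_iff by blast
  then show ?thesis
    by (simp add: power2_eq_iff_nonneg)
qed

lemma scaleR_eq_vector_scalar_mult: "t *\<^sub>R (x :: complex ^ 'n) = complex_of_real t *s x"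
  by (simp add: vec_eq_iff scaleR_conv_of_real[symmetric])

section \<open>Convexity of the field of values\<close>

text \<open>Normalising \<open>x\<close> divides the form by the squared norm, so later arguments
  may use nonzero vectors of any length.\<close>

lemma field_of_valuesI:
  assumes "x \<noteq> 0" "cinner_vec x (A *v x) = z * of_real ((norm x)\<^sup>2)"
  shows "z \<in> field_of_values A"
proof -
  define a where "a = complex_of_real (inverse (norm x))"
  have "norm (a *s x) = 1"
    using assms(1) by (simp add: a_def norm_vector_scalar_mult norm_inverse)
  moreover have "cinner_vec (a *s x) (A *v (a *s x)) = z"
    using assms by (simp add: a_def vec.scale cinner_vec_scale_left
        cinner_vec_scale_right power2_eq_square field_simps)
  ultimately show ?thesis
    unfolding field_of_values_def by blast
qed

lemma cnj_mult_self_unimodular: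
  assumes "cmod w = 1"
  shows "cnj w * w = 1"
  using complex_norm_square[of w] assms by (simp add: mult.commute)

lemma unimodular_mult_eq_iff:
  assumes "cmod w = 1"
  shows "w * z = a \<longleftrightarrow> z = a * cnj w"
proof -
  have "w * (a * cnj w) = a"
    using cnj_mult_self_unimodular[OF assms] by (metis mult.assoc mult.commute mult_1)
  moreover have "w \<noteq> 0"
    using assms by auto
  ultimately show ?thesis
    by (metis mult_left_cancel)
qed

text \<open>Take \<open>cnj z\<close> over its modulus, or 1 if \<open>z\<close> is zero. Such
  rotations turn moduli into real parts and remove imaginary parts.\<close>

lemma exists_phase: "\<exists>w. cmod w = 1 \<and> w * z = of_real (cmod z)"
proof (cases "z = 0")
  case True
  then show ?thesis by (intro exI[of _ 1]) simp
next
  case False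
  then show ?thesis
    by (intro exI[of _ "cnj z / of_real (cmod z)"])
      (simp add: norm_divide complex_norm_square[symmetric] power2_eq_square field_simps)
qed

text \<open>Toeplitz-Hausdorff: an affine change of the form moves the two given values to 0 and 1.
  Along a suitable segment of vectors the form is real, and the intermediate value theorem yields
  every value between.\<close>

theorem convex_field_of_values: "convex (field_of_values A)"
proof (rule convexI)
  fix a b and p q :: real
  assume a: "a \<in> field_of_values A" and b: "b \<in> field_of_values A"
    and pq: "0 \<le> p" "0 \<le> q" "p + q = 1"
  obtain u where u: "norm u = 1" "cinner_vec u (A *v u) = a"
    using a by (auto simp: field_of_values_def)
  obtain v where v: "norm v = 1" "cinner_vec v (A *v v) = b"
    using b by (auto simp: field_of_values_def)
  show "p *\<^sub>R a + q *\<^sub>R b \<in> field_of_values A"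
  proof (cases "a = b")
    case True
    then show ?thesis using a pq by (simp add: scaleR_left_distrib[symmetric])
  next
    case False
    text \<open>\<open>G x y\<close> is the form of \<open>(A - a)/(b - a)\<close>, which has the values 0 at \<open>u\<close> and 1 at \<open>v\<close>.\<close>
    define G where "G x y = (cinner_vec x (A *v y) - a * cinner_vec x y) / (b - a)" for x y
    have Ga: "G (x + y) z = G x z + G y z" "G z (x + y) = G z x + G z y" for x y z
      by (simp_all add: G_def cinner_vec_add_left cinner_vec_add_right vec.add add_divide_distrib[symmetric] algebra_simps)
    have Gs: "G (k *s x) y = cnj k * G x y" "G x (k *s y) = k * G x y" for k x y
      by (simp_all add: G_def cinner_vec_scale_left cinner_vec_scale_right vec.scale algebra_simps)
    have G0: "G u u = 0" "G v v = 1"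
      using u v False by (simp_all add: G_def cinner_vec_self)
    text \<open>A phase on \<open>v\<close> makes the cross term real, so that the form is real along a segment.\<close>
    obtain w where w: "cmod w = 1" "w * (G u v - cnj (G v u)) = of_real (cmod (G u v - cnj (G v u)))"
      using exists_phase by blast
    define v' where "v' = w *s v"
    have nv': "norm v' = 1"
      using v(1) w(1) by (simp add: v'_def norm_vector_scalar_mult)
    have "Im (w * (G u v - cnj (G v u))) = 0"
      using w(2) by simp
    \<comment> \<open>Conjugation negates imaginary parts, so \<open>- w * cnj (G v u)\<close> has
      the same imaginary part as \<open>cnj w * G v u\<close>, which is
      \<open>G v' u\<close>.\<close>
    then have im: "Im (G u v' + G v' u) = 0"
      by (simp add: v'_def Gs algebra_simps)
    have ww: "cnj w * w = 1"
      using w(1) by (rule cnj_mult_self_unimodular)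
    have G1: "G v' v' = 1"
      using ww G0 by (simp add: v'_def Gs mult.commute)
    define x where "x t = complex_of_real (1 - t) *s u + complex_of_real t *s v'" for t
    have Gx: "G (x t) (x t) = of_real (t\<^sup>2 + t * (1 - t) * Re (G u v' + G v' u))" for t
    proof -
      have "G (x t) (x t) = of_real (t * (1 - t)) * (G u v' + G v' u) + of_real (t\<^sup>2)"
        unfolding x_def Ga Gs using G0 G1 by (simp add: algebra_simps power2_eq_square)
      also have "G u v' + G v' u = of_real (Re (G u v' + G v' u))"
        using im by (simp add: complex_eq_iff)
      finally show ?thesis by simp
    qed
    \<comment> \<open>A zero would make \<open>v'\<close> a multiple of \<open>u\<close>, where the
      form vanishes, against \<open>G v' v' = 1\<close>.\<close>
    have nz: "x t \<noteq> 0" for t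
    proof
      assume eq: "x t = 0"
      have "t \<noteq> 0"
        using eq u by (auto simp: x_def)
      have "v' = complex_of_real (- (1 - t) / t) *s u"
        using eq \<open>t \<noteq> 0\<close> unfolding x_def vec_eq_iff by (auto simp: field_simps add_eq_0_iff)
      then have "G v' v' = 0"
        using G0 by (simp only: Gs) simp
      then show False using G1 by simp
    qed
    define f where "f t = Re (G (x t) (x t)) / (norm (x t))\<^sup>2" for t
    have "continuous_on {0..1} x"
      unfolding x_def scaleR_eq_vector_scalar_mult[symmetric] by (intro continuous_intros)
    then have "continuous_on {0..1} f"
      unfolding f_def Gx using nz by (intro continuous_intros) auto
    moreover have "f 0 = 0" "f 1 = 1"
      by (simp_all only: f_def Gx) (use nv' in \<open>simp_all add: x_def\<close>)
    ultimately obtain t where t: "f t = q"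
      using IVT'[of f 0 q 1] pq by auto
    have "G (x t) (x t) = of_real (q * (norm (x t))\<^sup>2)"
      using t nz[of t] Gx[of t] by (auto simp: f_def field_simps)
    then have "cinner_vec (x t) (A *v x t) = (a + of_real q * (b - a)) * of_real ((norm (x t))\<^sup>2)"
      using False by (simp add: G_def cinner_vec_self field_simps)
    moreover have "a + of_real q * (b - a) = p *\<^sub>R a + q *\<^sub>R b"
    proof -
      have p: "p = 1 - q" using pq by simp
      show ?thesis unfolding p by (simp add: scaleR_conv_of_real algebra_simps)
    qed
    ultimately show ?thesis
      using field_of_valuesI[OF nz] by metis
  qed
qed

section \<open>The largest eigenvalue of a Hermitian matrix\<close>

lemma hermitian_cinner_vec:
  assumes "hermitian M"
  shows "cinner_vec (M *v x) y = cinner_vec x (M *v y)"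
  using cinner_vec_ctranspose[of M x y] assms by (simp add: hermitian_def)

text \<open>Eigenvectors for distinct real eigenvalues are orthogonal, and pairwise orthogonal sets
  in a Euclidean space are finite. Finiteness lets the \<open>Max\<close> in
  \<open>lambda_max\<close> bound every real eigenvalue.\<close>

lemma finite_eigenvalues_hermitian:
  fixes M :: "complex ^ 'n ^ 'n"
  assumes "hermitian M"
  shows "finite {x::real. eigenvalue M (of_real x)}"
proof -
  define S where "S = {x::real. eigenvalue M (of_real x)}"
  define V where "V x = (SOME v. v \<noteq> 0 \<and> M *v v = complex_of_real x *s v)" for x
  have V: "V x \<noteq> 0" "M *v V x = complex_of_real x *s V x" if "x \<in> S" for x
    using that someI_ex[of "\<lambda>v. v \<noteq> 0 \<and> M *v v = complex_of_real x *s v"]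
    by (auto simp: S_def V_def eigenvalue_def)
  have orth: "V x \<bullet> V y = 0" if "x \<in> S" "y \<in> S" "x \<noteq> y" for x y
  proof -
    have "of_real x * cinner_vec (V x) (V y) = of_real y * cinner_vec (V x) (V y)"
      using hermitian_cinner_vec[OF assms, of "V x" "V y"] V that
      by (simp add: cinner_vec_scale_left cinner_vec_scale_right)
    then show ?thesis
      using that by (simp add: inner_eq_Re_cinner_vec)
  qed
  have "inj_on V S"
    by (rule inj_onI) (metis V(1) inner_eq_zero_iff orth)
  moreover have "pairwise orthogonal (V ` S)"
    using orth by (auto simp: pairwise_def orthogonal_def)
  then have "finite (V ` S)"
    by (rule pairwise_orthogonal_imp_finite)
  ultimately show ?thesis
    unfolding S_def using finite_imageD by blast
qed

text \<open>The form attains its maximum over the compact unit sphere, and a maximizer is an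
  eigenvector whose eigenvalue is that maximum.\<close>

lemma rayleigh_le_lambda_max:
  fixes M :: "complex ^ 'n ^ 'n"
  assumes "hermitian M"
  shows "x \<bullet> (M *v x) \<le> lambda_max M * (norm x)\<^sup>2"
proof -
  have add: "M *v (x + y) = M *v x + M *v y" for x y
    by (rule vec.add)
  have scale: "M *v (t *\<^sub>R x) = t *\<^sub>R (M *v x)" for t x
    by (simp add: scaleR_eq_vector_scalar_mult vec.scale)
  have sym: "(M *v x) \<bullet> y = x \<bullet> (M *v y)" for x y
    by (simp add: inner_eq_Re_cinner_vec hermitian_cinner_vec[OF assms])
  have "linear (\<lambda>x. M *v x)"
    using add scale by (intro linearI)
  then have "continuous_on S (\<lambda>x. M *v x)" for S
    by (simp add: linear_continuous_on linear_linear)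
  then have "continuous_on (sphere 0 1) (\<lambda>x. x \<bullet> (M *v x))"
    by (intro continuous_intros)
  moreover have "axis undefined 1 \<in> sphere (0 :: complex ^ 'n) 1"
    by simp
  ultimately obtain v where v: "v \<in> sphere 0 1"
      and max: "\<And>x. x \<in> sphere 0 1 \<Longrightarrow> x \<bullet> (M *v x) \<le> v \<bullet> (M *v v)"
    using continuous_attains_sup[OF compact_sphere, of 0 1] by blast
  define \<mu> where "\<mu> = v \<bullet> (M *v v)"
  define q where "q x = \<mu> * (x \<bullet> x) - x \<bullet> (M *v x)" for x
  have le: "0 \<le> q x" for x
  proof (cases "x = 0")
    case False
    define k where "k = inverse (norm x)"
    have "k *\<^sub>R x \<in> sphere 0 1"
      using False by (simp add: k_def)
    from max[OF this] have "k\<^sup>2 * (x \<bullet> (M *v x)) \<le> \<mu>"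
      by (simp add: scale \<mu>_def power2_eq_square)
    then show ?thesis
      using False by (simp add: k_def q_def power2_norm_eq_inner[symmetric] field_simps)
  qed (simp add: q_def)
  text \<open>The nonnegative quadratic function \<open>q\<close> vanishes at \<open>v\<close>, so its gradient does too.\<close>
  define g where "g = \<mu> *\<^sub>R v - M *v v"
  have "g = 0"
  proof (rule ccontr)
    assume "g \<noteq> 0"
    have "q v = 0"
      using v by (simp add: q_def \<mu>_def power2_norm_eq_inner[symmetric])
    have "q (v + t *\<^sub>R g) = q v + 2 * t * (g \<bullet> g) + t\<^sup>2 * q g" for t
    proof -
      have "v \<bullet> (M *v g) = g \<bullet> (M *v v)"
        by (metis sym inner_commute)
      then have "q (v + t *\<^sub>R g) = q v + 2 * t * (g \<bullet> (\<mu> *\<^sub>R v - M *v v)) + t\<^sup>2 * q g"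
        by (simp add: q_def add scale inner_add inner_diff_right power2_eq_square algebra_simps inner_commute[of v g])
      then show ?thesis by (simp add: g_def)
    qed
    then have *: "0 \<le> 2 * t * (g \<bullet> g) + t\<^sup>2 * q g" for t
      using le[of "v + t *\<^sub>R g"] \<open>q v = 0\<close> by simp
    \<comment> \<open>Moving from \<open>v\<close> by \<open>- s\<close> along \<open>g\<close>
      would make \<open>q\<close> negative, as \<open>s * q g\<close> stays below
      \<open>g \<bullet> g\<close>. The added 1 keeps the denominator positive when
      \<open>q g = 0\<close>.\<close>
    define s where "s = (g \<bullet> g) / (q g + 1)"
    have "0 < g \<bullet> g" "0 < q g + 1"
      using \<open>g \<noteq> 0\<close> le[of g] by simp_all
    then have s: "0 < s" "s * (q g + 1) = g \<bullet> g"
      by (simp_all add: s_def)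
    have "0 \<le> s * (s * q g - 2 * (g \<bullet> g))"
      using *[of "- s"] by (simp add: power2_eq_square algebra_simps)
    then have "2 * (g \<bullet> g) \<le> s * q g"
      using s(1) by (simp add: zero_le_mult_iff)
    then show False
      using s \<open>0 < g \<bullet> g\<close> by (simp add: algebra_simps)
  qed
  then have "M *v v = complex_of_real \<mu> *s v"
    by (simp add: g_def scaleR_eq_vector_scalar_mult)
  moreover have "v \<noteq> 0"
    using v by auto
  ultimately have "eigenvalue M (of_real \<mu>)"
    unfolding eigenvalue_def by blast
  then have "\<mu> \<le> lambda_max M"
    unfolding lambda_max_def using finite_eigenvalues_hermitian[OF assms] by (intro Max_ge) auto
  then have "\<mu> * (norm x)\<^sup>2 \<le> lambda_max M * (norm x)\<^sup>2"
    by (simp add: mult_right_mono)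
  moreover have "x \<bullet> (M *v x) \<le> \<mu> * (norm x)\<^sup>2"
    using le[of x] by (simp add: q_def power2_norm_eq_inner)
  ultimately show ?thesis by simp
qed

section \<open>The block matrix\<close>

definition join_vec :: "'a ^ 'n \<Rightarrow> 'a ^ 'm \<Rightarrow> 'a ^ ('n + 'm)" where
  "join_vec x y = (\<chi> k. case k of Inl i \<Rightarrow> x $ i | Inr i \<Rightarrow> y $ i)"

lemma sum_UNIV_Plus:
  fixes f :: "'a::finite + 'b::finite \<Rightarrow> 'c::comm_monoid_add"
  shows "(\<Sum>k\<in>UNIV. f k) = (\<Sum>i\<in>UNIV. f (Inl i)) + (\<Sum>i\<in>UNIV. f (Inr i))"
  by (simp add: UNIV_Plus_UNIV[symmetric] sum.Plus del: UNIV_Plus_UNIV)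

lemma cinner_vec_join_vec:
  "cinner_vec (join_vec x y) (join_vec x' y') = cinner_vec x x' + cinner_vec y y'"
  by (simp add: cinner_vec_def join_vec_def sum_UNIV_Plus)

lemma Phi_mult_join_vec:
  "Phi A Z *v join_vec x y = join_vec (Z *v x + A *v y) (ctranspose A *v x - Z *v y)"
  by (simp add: vec_eq_iff matrix_vector_mult_def Phi_def join_vec_def sum_UNIV_Plus sum_negf
      split: sum.split)

lemma hermitian_Phi:
  assumes "hermitian Z"
  shows "hermitian (Phi A Z)"
proof -
  have "cnj (Z $ i $ j) = Z $ j $ i" for i j
    using assms by (metis (no_types, lifting) ctranspose_def hermitian_def vec_lambda_beta)
  then show ?thesis
    by (simp add: hermitian_def ctranspose_def Phi_def vec_eq_iff split: sum.split)
qed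

text \<open>The off-diagonal blocks contribute \<open>w * cinner_vec x (A *v x)\<close> and its
  conjugate; the diagonal blocks cancel because \<open>w\<close> is unimodular.\<close>

lemma cinner_vec_Phi:
  assumes "cmod w = 1"
  shows "cinner_vec (join_vec x (w *s x)) (Phi A Z *v join_vec x (w *s x))
    = of_real (2 * Re (w * cinner_vec x (A *v x)))"
proof -
  have ww: "cnj w * w = 1"
    using assms by (rule cnj_mult_self_unimodular)
  have "cinner_vec x (ctranspose A *v x) = cnj (cinner_vec x (A *v x))"
    using cinner_vec_ctranspose[of "ctranspose A" x x] by (simp add: ctranspose_ctranspose cnj_cinner_vec)
  then have "cinner_vec (join_vec x (w *s x)) (Phi A Z *v join_vec x (w *s x))
      = w * cinner_vec x (A *v x) + cnj (w * cinner_vec x (A *v x))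
        + (1 - cnj w * w) * cinner_vec x (Z *v x)"
    by (simp add: Phi_mult_join_vec cinner_vec_join_vec cinner_vec_add_right cinner_vec_diff_right
        cinner_vec_scale_left cinner_vec_scale_right vec.scale algebra_simps)
  then show ?thesis
    unfolding ww complex_add_cnj by simp
qed

lemma cinner_vec_join_vec_self:
  assumes "cmod w = 1"
  shows "cinner_vec (join_vec x (w *s x)) (join_vec x (w *s x)) = of_real (2 * (norm x)\<^sup>2)"
  using assms unfolding cinner_vec_join_vec by (simp add: cinner_vec_self norm_vector_scalar_mult)

text \<open>The vectors \<open>join_vec x (w *s x)\<close> form the kernel of the map
  \<open>T\<close> below. If \<open>E\<close> met it only in 0, then \<open>T\<close> would embed
  \<open>E\<close> into a space of smaller dimension.\<close>

lemma exists_join_vec_in_subspace: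
  fixes E :: "(complex ^ ('n::finite + 'n)) set"
  assumes "vec.subspace E" "CARD('n) < vec.dim E"
  shows "\<exists>x. x \<noteq> 0 \<and> join_vec x (w *s x) \<in> E"
proof (rule ccontr)
  assume no: "\<nexists>x. x \<noteq> 0 \<and> join_vec x (w *s x) \<in> E"
  define T :: "complex ^ ('n + 'n) \<Rightarrow> complex ^ 'n"
    where "T v = (\<chi> i. v $ Inr i - w * v $ Inl i)" for v
  have lin: "Vector_Spaces.linear (*s) (*s) T"
    by unfold_locales (simp_all add: T_def vec_eq_iff algebra_simps)
  have "v = 0" if "v \<in> E" "T v = 0" for v
  proof -
    define x :: "complex ^ 'n" where "x = (\<chi> i. v $ Inl i)"
    have v: "v = join_vec x (w *s x)"
      using that(2) by (auto simp: T_def x_def join_vec_def vec_eq_iff split: sum.split)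
    then have "x = 0" using no that(1) by blast
    then show "v = 0" using v by (simp add: join_vec_def vec_eq_iff split: sum.split)
  qed
  then have "inj_on T E"
    using vec.linear_inj_on_iff_eq_0[OF lin assms(1)] by blast
  then have "vec.dim (T ` E) = vec.dim E"
    using assms(1) vec.dim_image_eq[OF lin, of E] by (metis vec.span_eq_iff)
  then show False
    using vec.dim_subset[of "T ` E" UNIV] assms(2) unfolding vec_dim_card by simp
qed

lemma subspace_eigenspace: "vec.subspace (eigenspace M \<mu>)"
  by (rule vec.subspaceI)
    (simp_all add: eigenspace_def vec.add vec.scale vec.scale_right_distrib vec.scale_left_commute)

section \<open>Disk matrices\<close>

lemma disk_matrixI:
  assumes "field_of_values A = cball 0 c" "0 \<le> c"
  shows "disk_matrix A"
proof -
  \<comment> \<open>The numerical radius is the supremum of these moduli, hence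
    \<open>c\<close>.\<close>
  have "cmod ` cball 0 c = {0..c}"
  proof (intro equalityI subsetI)
    fix t assume "t \<in> {0..c}"
    then show "t \<in> cmod ` cball 0 c"
      by (intro image_eqI[of _ _ "of_real t"]) auto
  qed auto
  then have "numerical_radius A = c"
    using assms by (simp add: numerical_radius_def)
  then show ?thesis
    unfolding disk_matrix_def assms(1) by (simp add: set_eq_iff)
qed

theorem disk_matrix_of_multiplicity:
  fixes A Z :: "complex ^ 'n ^ 'n"
  assumes herm: "hermitian Z"
    and mult: "CARD('n) < multiplicity_of (Phi A Z) (of_real (lambda_max (Phi A Z)))"
  shows "disk_matrix A"
proof -
  define c where "c = lambda_max (Phi A Z)"
  have upper: "cmod z \<le> c" if z: "z \<in> field_of_values A" for z
  proof -
    obtain u where u: "norm u = 1" "cinner_vec u (A *v u) = z"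
      using z by (auto simp: field_of_values_def)
    \<comment> \<open>This rotation turns the real part in \<open>cinner_vec_Phi\<close> into
      \<open>cmod z\<close>; the factor 2 there cancels against the squared norm 2 of
      \<open>e\<close>.\<close>
    obtain w where w: "cmod w = 1" "w * z = of_real (cmod z)"
      using exists_phase by blast
    define e where "e = join_vec u (w *s u)"
    have "e \<bullet> (Phi A Z *v e) = 2 * cmod z"
      using cinner_vec_Phi[OF w(1), of u A Z] u w(2) by (simp add: e_def inner_eq_Re_cinner_vec)
    moreover have "(norm e)\<^sup>2 = 2"
      using cinner_vec_join_vec_self[OF w(1), of u] u
      by (simp add: e_def inner_eq_Re_cinner_vec power2_norm_eq_inner)
    ultimately show ?thesis
      using rayleigh_le_lambda_max[OF hermitian_Phi[OF herm], of e A] by (simp add: c_def)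
  qed
  have circle: "of_real c * cnj w \<in> field_of_values A" if w: "cmod w = 1" for w
  proof -
    obtain x where x: "x \<noteq> 0" "join_vec x (w *s x) \<in> eigenspace (Phi A Z) (of_real c)"
      using exists_join_vec_in_subspace[OF subspace_eigenspace] mult
      unfolding multiplicity_of_def c_def by blast
    define z where "z = cinner_vec x (A *v x) / of_real ((norm x)\<^sup>2)"
    have zx: "cinner_vec x (A *v x) = z * of_real ((norm x)\<^sup>2)"
      using x(1) by (simp add: z_def)
    then have z: "z \<in> field_of_values A"
      using field_of_valuesI[OF x(1)] by blast
    have "complex_of_real (2 * Re (w * cinner_vec x (A *v x))) = of_real (c * (2 * (norm x)\<^sup>2))"
      using cinner_vec_Phi[OF w, of x A Z] cinner_vec_join_vec_self[OF w, of x] x(2)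
      by (simp add: eigenspace_def cinner_vec_scale_right)
    then have "Re (w * cinner_vec x (A *v x)) = c * (norm x)\<^sup>2"
      unfolding of_real_eq_iff by simp
    then have "Re (w * z) * (norm x)\<^sup>2 = c * (norm x)\<^sup>2"
      unfolding zx by (simp add: algebra_simps)
    then have re: "Re (w * z) = c"
      using x(1) by simp
    \<comment> \<open>A number with real part \<open>c\<close> and modulus at most \<open>c\<close>
      has no imaginary part.\<close>
    have "cmod (w * z) \<le> c"
      using upper[OF z] w by (simp add: norm_mult)
    then have "(cmod (w * z))\<^sup>2 \<le> c\<^sup>2"
      by (intro power_mono) simp_all
    then have "Im (w * z) = 0"
      unfolding cmod_power2 re by simp
    then have "w * z = of_real c"
      using re by (simp add: complex_eq_iff)
    then have "z = of_real c * cnj w"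
      using unimodular_mult_eq_iff[OF w] by blast
    then show ?thesis using z by simp
  qed
  \<comment> \<open>The circle supplies a point of the field of values, whose modulus is nonnegative
    and at most \<open>c\<close>.\<close>
  have c: "0 \<le> c"
    using upper[OF circle[of 1]] by simp
  have "z \<in> field_of_values A" if "cmod z \<le> c" for z
  proof -
    obtain w where w: "cmod w = 1" "w * z = of_real (cmod z)"
      using exists_phase by blast
    show ?thesis
    proof (cases "c = 0")
      case True
      then show ?thesis using that circle[of 1] by simp
    next
      case False
      \<comment> \<open>The point \<open>z\<close> lies on the diameter from
        \<open>- c * cnj w\<close> to \<open>c * cnj w\<close>; its position \<open>s\<close> there
        solves \<open>c * (2 * s - 1) = cmod z\<close>.\<close>
      define s where "s = (1 + cmod z / c) / 2"
      have s: "0 \<le> 1 - s" "0 \<le> s" "1 - s + s = 1" "c * (2 * s - 1) = cmod z"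
        using that c False by (simp_all add: s_def field_simps)
      have "z = of_real (cmod z) * cnj w"
        using unimodular_mult_eq_iff[OF w(1)] w(2) by blast
      also have "\<dots> = (1 - s) *\<^sub>R (of_real c * cnj (- w)) + s *\<^sub>R (of_real c * cnj w)"
        unfolding s(4)[symmetric] by (simp add: scaleR_conv_of_real algebra_simps)
      also have "\<dots> \<in> field_of_values A"
        using w(1) by (intro convexD[OF convex_field_of_values] circle s) simp_all
      finally show ?thesis .
    qed
  qed
  then have "field_of_values A = cball 0 c"
    using upper by auto
  then show ?thesis
    using c by (rule disk_matrixI)
qed

theorem theorem6p1:
  fixes A :: "complex ^ 'n ^ 'n"
  assumes "CARD('n) > 1"
    and "\<exists>!Z. sdp_representor A Z"
    and "multiplicity_property A"
  shows "disk_matrix A"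
proof -
  obtain Z where "sdp_representor A Z"
    and "CARD('n) < multiplicity_of (Phi A Z) (of_real (lambda_max (Phi A Z)))"
    using assms(3) unfolding multiplicity_property_def by blast
  then show ?thesis
    \<comment> \<open>Minimizers are taken among Hermitian matrices, so \<open>Z\<close> is
      Hermitian.\<close>
    by (intro disk_matrix_of_multiplicity) (simp_all add: sdp_representor_def is_arg_min_def)
qed

end
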